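(* Let $X$ and $Y$ be compact Hausdorff spaces, let $C(X)$ and $C(Y)$ be the lattices of real-valued continuous functions on $X$ and $Y$ with the pointwise ordering, and let $S\colon C(X)\to C(Y)$ be a lattice isomorphism. Then the map $T\colon C(X)\to C(Y)$ given by $Tf=Sf-S0$ $(f\in C(X))$ is a lattice isomorphism between $C(X)$ and $C(Y)$ which is also a compatibility isomorphism.
   Context: Scalars are real: $C(X)$ is the set of all continuous functions $X\to\mathbb{R}$, a lattice under the pointwise ordering with pointwise operations $\min\{f,g\}$ and $\max\{f,g\}$. A lattice isomorphism is a bijection preserving both lattice operations (equivalently, a bijection such that $f\leqslant g$ if and only if $Sf\leqslant Sg$); it is not assumed linear. For a function $f$ on $X$, $\operatorname{supp} f$ is the closure of $\{x\in X\colon f(x)\neq 0\}$. The compatibility ordering on $C(X)$ is the partial order defined by: $f\preceq g$ if and only if $f(x)=g(x)$ for every $x\in\operatorname{supp} f$. A map $T\colon C(X)\to C(Y)$ (not assumed linear or continuous) is a compatibility morphism if $f\preceq g$ implies $Tf\preceq Tg$ for all $f,g\in C(X)$; a compatibility isomorphism is a bijective compatibility morphism whose inverse is also a compatibility morphism. *)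

theory Defs
  imports "HOL-Analysis.Analysis"
begin

text \<open>
  Spaces are abstract topologies, so the empty space is allowed. An element of \<open>C(X)\<close> is
  represented by a function that is extensional on the carrier of \<open>X\<close> (equal to
  \<^term>\<open>undefined\<close> outside it), so that HOL equality coincides with equality of
  functions on \<open>X\<close>.
\<close>

definition C_of :: "'a topology \<Rightarrow> ('a \<Rightarrow> real) set" where
  "C_of X = {f \<in> extensional (topspace X). continuous_map X euclideanreal f}"

definition C_zero :: "'a topology \<Rightarrow> 'a \<Rightarrow> real" where
  "C_zero X = (\<lambda>x\<in>topspace X. 0)"

definition C_min :: "'a topology \<Rightarrow> ('a \<Rightarrow> real) \<Rightarrow> ('a \<Rightarrow> real) \<Rightarrow> 'a \<Rightarrow> real" where
  "C_min X f g = (\<lambda>x\<in>topspace X. min (f x) (g x))"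

definition C_max :: "'a topology \<Rightarrow> ('a \<Rightarrow> real) \<Rightarrow> ('a \<Rightarrow> real) \<Rightarrow> 'a \<Rightarrow> real" where
  "C_max X f g = (\<lambda>x\<in>topspace X. max (f x) (g x))"

definition C_diff :: "'a topology \<Rightarrow> ('a \<Rightarrow> real) \<Rightarrow> ('a \<Rightarrow> real) \<Rightarrow> 'a \<Rightarrow> real" where
  "C_diff X f g = (\<lambda>x\<in>topspace X. f x - g x)"

definition lattice_isomorphism ::
    "'a topology \<Rightarrow> 'b topology \<Rightarrow> (('a \<Rightarrow> real) \<Rightarrow> ('b \<Rightarrow> real)) \<Rightarrow> bool" where
  "lattice_isomorphism X Y S \<longleftrightarrow>
     bij_betw S (C_of X) (C_of Y) \<and>
     (\<forall>f\<in>C_of X. \<forall>g\<in>C_of X.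
        S (C_min X f g) = C_min Y (S f) (S g) \<and>
        S (C_max X f g) = C_max Y (S f) (S g))"

definition supp :: "'a topology \<Rightarrow> ('a \<Rightarrow> real) \<Rightarrow> 'a set" where
  "supp X f = X closure_of {x \<in> topspace X. f x \<noteq> 0}"

definition compat_le :: "'a topology \<Rightarrow> ('a \<Rightarrow> real) \<Rightarrow> ('a \<Rightarrow> real) \<Rightarrow> bool" where
  "compat_le X f g \<longleftrightarrow> (\<forall>x\<in>supp X f. f x = g x)"

definition compatibility_morphism ::
    "'a topology \<Rightarrow> 'b topology \<Rightarrow> (('a \<Rightarrow> real) \<Rightarrow> ('b \<Rightarrow> real)) \<Rightarrow> bool" where
  "compatibility_morphism X Y T \<longleftrightarrow>
     T \<in> C_of X \<rightarrow> C_of Y \<and>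
     (\<forall>f\<in>C_of X. \<forall>g\<in>C_of X. compat_le X f g \<longrightarrow> compat_le Y (T f) (T g))"

definition compatibility_isomorphism ::
    "'a topology \<Rightarrow> 'b topology \<Rightarrow> (('a \<Rightarrow> real) \<Rightarrow> ('b \<Rightarrow> real)) \<Rightarrow> bool" where
  "compatibility_isomorphism X Y T \<longleftrightarrow>
     bij_betw T (C_of X) (C_of Y) \<and>
     compatibility_morphism X Y T \<and>
     compatibility_morphism Y X (inv_into (C_of X) T)"

end

theory Submission
  imports Defs
begin

text \<open>
  Subtracting the fixed function \<open>S 0\<close> is a lattice automorphism of \<open>C(Y)\<close>, so \<open>T\<close> is a lattice
  isomorphism, and it fixes zero. The content is that any lattice isomorphism fixing zero
  respects the compatibility ordering, and for this it suffices to describe that ordering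
  by lattice operations and the constant zero.

  By continuity, \<open>f \<preceq> g\<close> says that \<open>f\<close> and \<open>g\<close> agree wherever \<open>f \<noteq> 0\<close>, that is, that \<open>f\<close> and the
  difference \<open>h = g - f\<close> have disjoint non-zero sets. So \<open>g\<close> is a disjoint sum of \<open>f\<close> and \<open>h\<close>,
  and a disjoint sum is determined by lattice operations on the positive and on the negative
  parts:
  \<open>max f 0\<close> and \<open>max h 0\<close> have minimum \<open>0\<close> and maximum \<open>max g 0\<close>, and dually for
  \<open>min f 0\<close>, \<open>min h 0\<close> and \<open>min g 0\<close>. These four identities survive under \<open>T\<close>; read pointwise in
  \<open>Y\<close> they force \<open>T g = T f\<close> wherever \<open>T f \<noteq> 0\<close>. The inverse of \<open>T\<close> is again a lattice
  isomorphism fixing zero, so it respects the ordering as well.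
\<close>

lemma C_zero_in_C_of: "C_zero X \<in> C_of X"
  by (auto simp: C_zero_def C_of_def)

lemma C_min_in_C_of: "f \<in> C_of X \<Longrightarrow> g \<in> C_of X \<Longrightarrow> C_min X f g \<in> C_of X"
  by (auto simp: C_min_def C_of_def intro: continuous_map_real_min)

lemma C_max_in_C_of: "f \<in> C_of X \<Longrightarrow> g \<in> C_of X \<Longrightarrow> C_max X f g \<in> C_of X"
  by (auto simp: C_max_def C_of_def intro: continuous_map_real_max)

lemma C_diff_in_C_of: "f \<in> C_of X \<Longrightarrow> g \<in> C_of X \<Longrightarrow> C_diff X f g \<in> C_of X"
  by (auto simp: C_diff_def C_of_def intro: continuous_map_diff)

text \<open>
  Two continuous functions that agree where \<open>f\<close> is non-zero also agree on the closure of that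
  set, so compatibility can be tested pointwise, without reference to the topology.
\<close>

lemma compat_le_iff_eq_where_nonzero:
  assumes "f \<in> C_of X" "g \<in> C_of X"
  shows "compat_le X f g \<longleftrightarrow> (\<forall>x\<in>topspace X. f x \<noteq> 0 \<longrightarrow> f x = g x)"
proof
  assume "compat_le X f g"
  moreover have "{x \<in> topspace X. f x \<noteq> 0} \<subseteq> supp X f"
    unfolding supp_def by (rule closure_of_subset) auto
  ultimately show "\<forall>x\<in>topspace X. f x \<noteq> 0 \<longrightarrow> f x = g x"
    unfolding compat_le_def by auto
next
  assume "\<forall>x\<in>topspace X. f x \<noteq> 0 \<longrightarrow> f x = g x"
  with assms show "compat_le X f g"
    unfolding compat_le_def supp_def C_of_def
    by (auto elim!: forall_in_closure_of_eq[where Y = euclideanreal])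
qed

lemma lattice_isomorphism_inv_into:
  assumes "lattice_isomorphism X Y S"
  shows "lattice_isomorphism Y X (inv_into (C_of X) S)"
proof -
  let ?R = "inv_into (C_of X) S"
  have bij: "bij_betw S (C_of X) (C_of Y)"
    using assms by (simp add: lattice_isomorphism_def)
  have "?R (C_min Y u v) = C_min X (?R u) (?R v) \<and> ?R (C_max Y u v) = C_max X (?R u) (?R v)"
    if "u \<in> C_of Y" "v \<in> C_of Y" for u v
  proof -
    have R: "?R u \<in> C_of X" "?R v \<in> C_of X" "S (?R u) = u" "S (?R v) = v"
      using bij that
      by (auto simp: bij_betw_inv_into_right intro: bij_betwE[OF bij_betw_inv_into, rule_format])
    then have "C_min Y u v = S (C_min X (?R u) (?R v))" "C_max Y u v = S (C_max X (?R u) (?R v))"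
      using assms by (auto simp: lattice_isomorphism_def)
    then show ?thesis
      using bij R by (simp add: bij_betw_inv_into_left C_min_in_C_of C_max_in_C_of)
  qed
  with bij show ?thesis
    by (simp add: lattice_isomorphism_def bij_betw_inv_into)
qed

text \<open>
  Subtraction of \<open>c\<close> has the inverse \<open>u \<mapsto> u + c\<close>, and it commutes with pointwise minima and
  maxima.
\<close>

lemma lattice_isomorphism_translate:
  assumes S: "lattice_isomorphism X Y S" and c: "c \<in> C_of Y"
    and T: "\<And>f. f \<in> C_of X \<Longrightarrow> T f = C_diff Y (S f) c"
  shows "lattice_isomorphism X Y T"
proof -
  have bij: "bij_betw S (C_of X) (C_of Y)"
    using S by (simp add: lattice_isomorphism_def)
  have "bij_betw (\<lambda>u. C_diff Y u c) (C_of Y) (C_of Y)"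
  proof (rule bij_betw_byWitness[where f' = "\<lambda>u. \<lambda>y\<in>topspace Y. u y + c y"])
    show "(\<lambda>u. \<lambda>y\<in>topspace Y. u y + c y) ` C_of Y \<subseteq> C_of Y"
      using c by (auto simp: C_of_def intro: continuous_map_add)
    show "(\<lambda>u. C_diff Y u c) ` C_of Y \<subseteq> C_of Y"
      using c C_diff_in_C_of by blast
    show "\<forall>u\<in>C_of Y. (\<lambda>y\<in>topspace Y. C_diff Y u c y + c y) = u"
      by (auto simp: C_of_def C_diff_def extensional_def fun_eq_iff)
    show "\<forall>u\<in>C_of Y. C_diff Y (\<lambda>y\<in>topspace Y. u y + c y) c = u"
      by (auto simp: C_of_def C_diff_def extensional_def fun_eq_iff)
  qed
  then have "bij_betw ((\<lambda>u. C_diff Y u c) \<circ> S) (C_of X) (C_of Y)"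
    using bij bij_betw_trans by blast
  then have "bij_betw T (C_of X) (C_of Y)"
    using T by (subst bij_betw_cong[where g = "(\<lambda>u. C_diff Y u c) \<circ> S"]) auto
  moreover have "T (C_min X f g) = C_min Y (T f) (T g) \<and> T (C_max X f g) = C_max Y (T f) (T g)"
    if "f \<in> C_of X" "g \<in> C_of X" for f g
  proof -
    have "S (C_min X f g) = C_min Y (S f) (S g)" "S (C_max X f g) = C_max Y (S f) (S g)"
      using that S by (auto simp: lattice_isomorphism_def)
    then have "T (C_min X f g) = C_diff Y (C_min Y (S f) (S g)) c"
      "T (C_max X f g) = C_diff Y (C_max Y (S f) (S g)) c"
      using that by (simp_all add: T C_min_in_C_of C_max_in_C_of)
    then show ?thesis
      using that by (auto simp: T C_diff_def C_min_def C_max_def min_def max_def intro!: restrict_ext)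
  qed
  ultimately show ?thesis
    by (simp add: lattice_isomorphism_def)
qed

text \<open>
  The four lattice identities between \<open>f\<close>, \<open>g\<close> and \<open>h = g - f\<close> below only involve operations
  that \<open>T\<close> preserves. At a point where \<open>T f > 0\<close>, the minimum of the positive parts shows
  \<open>T h \<le> 0\<close>, and the maximum then gives \<open>T g = T f\<close>; negative values are dual. The signs
  are treated separately because \<open>f\<close> and \<open>h\<close> may change sign, and then \<open>g\<close> need be neither
  their maximum nor their minimum.
\<close>

lemma lattice_isomorphism_zero_imp_compatibility_morphism:
  assumes T: "lattice_isomorphism X Y T" and zero: "T (C_zero X) = C_zero Y"
  shows "compatibility_morphism X Y T"
proof -
  have bij: "bij_betw T (C_of X) (C_of Y)"
    and T_min: "\<And>f g. f \<in> C_of X \<Longrightarrow> g \<in> C_of X \<Longrightarrow> T (C_min X f g) = C_min Y (T f) (T g)"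
    and T_max: "\<And>f g. f \<in> C_of X \<Longrightarrow> g \<in> C_of X \<Longrightarrow> T (C_max X f g) = C_max Y (T f) (T g)"
    using T by (auto simp: lattice_isomorphism_def)
  have maps: "T f \<in> C_of Y" if "f \<in> C_of X" for f
    using bij that bij_betwE by blast
  have "compat_le Y (T f) (T g)"
    if f: "f \<in> C_of X" and g: "g \<in> C_of X" and le: "compat_le X f g" for f g
  proof -
    define h where "h = C_diff X g f"
    have h: "h \<in> C_of X"
      unfolding h_def using f g by (rule C_diff_in_C_of[rotated])
    have disjoint: "f x = 0 \<and> h x = g x \<or> h x = 0 \<and> f x = g x" if "x \<in> topspace X" for x
      using le that f g by (auto simp: compat_le_iff_eq_where_nonzero h_def C_diff_def)
    note closed = f g h C_zero_in_C_of C_min_in_C_of C_max_in_C_of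
    have inf_pos: "C_min X (C_max X f (C_zero X)) (C_max X h (C_zero X)) = C_zero X"
      unfolding C_min_def C_max_def C_zero_def
      by (rule restrict_ext) (frule disjoint, auto simp: min_def max_def)
    have sup_pos: "C_max X (C_max X f (C_zero X)) (C_max X h (C_zero X)) = C_max X g (C_zero X)"
      unfolding C_max_def C_zero_def
      by (rule restrict_ext) (frule disjoint, auto simp: min_def max_def)
    have sup_neg: "C_max X (C_min X f (C_zero X)) (C_min X h (C_zero X)) = C_zero X"
      unfolding C_min_def C_max_def C_zero_def
      by (rule restrict_ext) (frule disjoint, auto simp: min_def max_def)
    have inf_neg: "C_min X (C_min X f (C_zero X)) (C_min X h (C_zero X)) = C_min X g (C_zero X)"
      unfolding C_min_def C_zero_def
      by (rule restrict_ext) (frule disjoint, auto simp: min_def max_def)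
    have "T f y = T g y" if y: "y \<in> topspace Y" and nonzero: "T f y \<noteq> 0" for y
    proof -
      have "min (max (T f y) 0) (max (T h y) 0) = 0"
        using arg_cong[OF inf_pos, of "\<lambda>k. T k y"] y
        by (simp add: T_min T_max zero closed) (simp add: C_min_def C_max_def C_zero_def)
      moreover have "max (max (T f y) 0) (max (T h y) 0) = max (T g y) 0"
        using arg_cong[OF sup_pos, of "\<lambda>k. T k y"] y
        by (simp add: T_min T_max zero closed) (simp add: C_max_def C_zero_def)
      moreover have "max (min (T f y) 0) (min (T h y) 0) = 0"
        using arg_cong[OF sup_neg, of "\<lambda>k. T k y"] y
        by (simp add: T_min T_max zero closed) (simp add: C_min_def C_max_def C_zero_def)
      moreover have "min (min (T f y) 0) (min (T h y) 0) = min (T g y) 0"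
        using arg_cong[OF inf_neg, of "\<lambda>k. T k y"] y
        by (simp add: T_min T_max zero closed) (simp add: C_min_def C_zero_def)
      ultimately show ?thesis
        using nonzero by linarith
    qed
    then show ?thesis
      using maps f g by (simp add: compat_le_iff_eq_where_nonzero)
  qed
  with maps show ?thesis
    by (simp add: compatibility_morphism_def)
qed

theorem proposition2p5:
  fixes X :: "'a topology" and Y :: "'b topology"
    and S T :: "('a \<Rightarrow> real) \<Rightarrow> ('b \<Rightarrow> real)"
  assumes "compact_space X" and "Hausdorff_space X"
    and "compact_space Y" and "Hausdorff_space Y"
    and "lattice_isomorphism X Y S"
    and "\<And>f. f \<in> C_of X \<Longrightarrow> T f = C_diff Y (S f) (S (C_zero X))"
  shows "lattice_isomorphism X Y T \<and> compatibility_isomorphism X Y T"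
proof -
  have S_zero: "S (C_zero X) \<in> C_of Y"
    using assms(5) C_zero_in_C_of by (auto simp: lattice_isomorphism_def dest: bij_betwE)
  have T: "lattice_isomorphism X Y T"
    by (rule lattice_isomorphism_translate[OF assms(5) S_zero assms(6)])
  then have bij: "bij_betw T (C_of X) (C_of Y)"
    by (simp add: lattice_isomorphism_def)
  have T_zero: "T (C_zero X) = C_zero Y"
    using assms(6)[OF C_zero_in_C_of] by (simp add: C_diff_def C_zero_def)
  have inv_zero: "inv_into (C_of X) T (C_zero Y) = C_zero X"
    using bij C_zero_in_C_of by (metis T_zero bij_betw_inv_into_left)
  have "compatibility_morphism X Y T"
    using T T_zero by (rule lattice_isomorphism_zero_imp_compatibility_morphism)
  moreover have "compatibility_morphism Y X (inv_into (C_of X) T)"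
    using lattice_isomorphism_inv_into[OF T] inv_zero
    by (rule lattice_isomorphism_zero_imp_compatibility_morphism)
  ultimately show ?thesis
    using T bij by (simp add: compatibility_isomorphism_def)
qed

end
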